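(* Let $x\in[0,1]$ be a quadratic irrational (an irrational root of a nonzero quadratic polynomial with rational coefficients). Then $\mathcal{I}(x)$ is a rational number.
   Context: For $x\in\mathbb{R}$ let $\{x\}=x-\lfloor x\rfloor$. The interrobang function $\mathcal{I}\colon[0,1]\cap\mathbb{Q}\to\mathbb{R}$ is defined recursively by $\mathcal{I}(0)=0$; $\mathcal{I}(x)=4^{-\lfloor1/x\rfloor}\big(1-2\,\mathcal{I}(\{1/x\})\big)$ if $0<x\le\tfrac12$; and $\mathcal{I}(x)=\tfrac38-\tfrac34\,\mathcal{I}(1/x-1)-\tfrac12\,\mathcal{I}(1-x)$ if $\tfrac12<x\le1$ (well founded by the height $a/b\mapsto|a|+|b|$). It is a fact (proved in the paper) that this function extends uniquely to a continuous strictly increasing function $\mathcal{I}\colon[0,1]\to\mathbb{R}$, which satisfies the same three functional equations for all real $x\in[0,1]$; $\mathcal{I}(x)$ for irrational $x$ refers to this extension. *)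

theory Defs
  imports Complex_Main
begin

definition interrobang_eqs :: "(real \<Rightarrow> real) \<Rightarrow> bool" where
  "interrobang_eqs f \<longleftrightarrow>
     f 0 = 0 \<and>
     (\<forall>x. 0 < x \<and> x \<le> 1/2 \<longrightarrow>
        f x = (1/4) ^ nat \<lfloor>1/x\<rfloor> * (1 - 2 * f (frac (1/x)))) \<and>
     (\<forall>x. 1/2 < x \<and> x \<le> 1 \<longrightarrow>
        f x = 3/8 - 3/4 * f (1/x - 1) - 1/2 * f (1 - x))"

text \<open>The interrobang function: the unique continuous strictly increasing function on [0,1]
  satisfying the functional equations (normalised to 0 outside [0,1] to make it unique).
  On rationals these equations are exactly the defining recursion.\<close>
definition interrobang :: "real \<Rightarrow> real" where
  "interrobang = (THE f. continuous_on {0..1} f \<and> strict_mono_on {0..1} f \<and>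
                          interrobang_eqs f \<and> (\<forall>x. x \<notin> {0..1} \<longrightarrow> f x = 0))"

definition quadratic_irrational :: "real \<Rightarrow> bool" where
  "quadratic_irrational x \<longleftrightarrow> x \<notin> \<rat> \<and>
     (\<exists>a b c :: rat. (a, b, c) \<noteq> (0, 0, 0) \<and>
        of_rat a * x ^ 2 + of_rat b * x + of_rat c = 0)"

end

theory Submission
  imports Defs "HOL-Analysis.Analysis"
begin

text \<open>
  Let \<open>G x = {1/x}\<close>.  Substituting the second functional equation into the third, the interrobang
  function \<open>f\<close> satisfies \<open>f x = c + a f(G x) + b f(G (G x))\<close> with coefficients that are rational for
  each \<open>x\<close> and satisfy \<open>\<bar>a\<bar> + \<bar>b\<bar> \<le> 13/16\<close>.  This contraction yields existence (with continuity and
  monotonicity inherited from the iterates) and uniqueness of \<open>f\<close>.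

  The \<open>G\<close>-orbit of a quadratic irrational is finite.  Choose a \<open>\<rat>\<close>-linear projection
  \<open>\<phi> : \<real> \<rightarrow> \<rat>\<close>.  On the orbit, \<open>f\<close> and \<open>\<phi> \<circ> f\<close> solve the same rational linear system, so the
  maximum of \<open>\<bar>f - \<phi> \<circ> f\<bar>\<close> over the orbit is at most \<open>13/16\<close> of itself.  Hence \<open>f = \<phi> \<circ> f\<close> there.
\<close>

section \<open>The Gauss map and the contracting operator\<close>

definition gauss_map :: "real \<Rightarrow> real" where
  "gauss_map x = frac (1 / x)"

text \<open>The right-hand side of the second equation; its operator norm on \<open>[0, 1/2]\<close> is \<open>2/4\<^sup>2 = 1/8\<close>.\<close>
definition lower_branch :: "(real \<Rightarrow> real) \<Rightarrow> real \<Rightarrow> real" where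
  "lower_branch f x = (if x = 0 then 0 else (1/4) ^ nat \<lfloor>1/x\<rfloor> * (1 - 2 * f (frac (1/x))))"

text \<open>The summand \<open>f (1 - x)\<close> of the third equation is replaced by its own expansion, which lowers the
  contraction factor from \<open>3/4 + 1/2\<close> to \<open>3/4 + 1/16\<close>.\<close>
definition interrobang_op :: "(real \<Rightarrow> real) \<Rightarrow> real \<Rightarrow> real" where
  "interrobang_op f x =
     (if x \<le> 1/2 then lower_branch f x
      else 3/8 - 3/4 * f (1/x - 1) - 1/2 * lower_branch f (1 - x))"

text \<open>Monotonicity is not strict here, so that the class passes to uniform limits. The third
  equation forces the value \<open>3/8\<close> at \<open>1\<close>, and this value makes adjacent
  branches agree at their common endpoints.\<close>

definition admissible :: "(real \<Rightarrow> real) \<Rightarrow> bool" where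
  "admissible f \<longleftrightarrow> continuous_on {0..1} f \<and> mono_on {0..1} f \<and> f 0 = 0 \<and> f 1 = 3/8"

lemma admissible_bounds:
  assumes "admissible f" "x \<in> {0..1}"
  shows "0 \<le> f x" "f x \<le> 3/8"
proof -
  have m: "mono_on {0..1} f" "f 0 = 0" "f 1 = 3/8" using assms by (auto simp: admissible_def)
  show "0 \<le> f x" using mono_onD[OF m(1), of 0 x] m assms(2) by auto
  show "f x \<le> 3/8" using mono_onD[OF m(1), of x 1] m assms(2) by auto
qed

lemma frac_unit_interval: "frac x \<in> {0..1}" for x :: real
  using frac_lt_1[of x] by (simp add: less_imp_le)

lemma quarter_power_le: "2 \<le> n \<Longrightarrow> (1/4::real) ^ n \<le> 1/16"
  using power_decreasing[of 2 n "1/4::real"] by (simp add: power2_eq_square)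

lemma two_le_floor_inverse:
  assumes "0 < x" "x \<le> 1/2"
  shows "2 \<le> nat \<lfloor>1/x\<rfloor>"
proof -
  have "2 \<le> 1/x" using assms by (simp add: field_simps)
  then have "2 \<le> \<lfloor>1/x\<rfloor>" by (simp add: le_floor_iff)
  then show ?thesis by linarith
qed

lemma lower_branch_contracts:
  assumes "\<And>y. y \<in> {0..1} \<Longrightarrow> \<bar>f y - g y\<bar> \<le> M" and "0 \<le> x" "x \<le> 1/2"
  shows "\<bar>lower_branch f x - lower_branch g x\<bar> \<le> M / 8"
proof (cases "x = 0")
  case True
  then show ?thesis using assms(1)[of 0] by (simp add: lower_branch_def)
next
  case False
  define q where "q = (1/4::real) ^ nat \<lfloor>1/x\<rfloor>"
  have q: "0 \<le> q" "q \<le> 1/16"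
    using quarter_power_le[OF two_le_floor_inverse[of x]] assms False by (auto simp: q_def)
  have d: "\<bar>f (frac (1/x)) - g (frac (1/x))\<bar> \<le> M"
    by (rule assms(1)[OF frac_unit_interval])
  have "lower_branch f x - lower_branch g x = - (2 * q) * (f (frac (1/x)) - g (frac (1/x)))"
    using False by (simp add: lower_branch_def q_def algebra_simps)
  then have "\<bar>lower_branch f x - lower_branch g x\<bar> = 2 * q * \<bar>f (frac (1/x)) - g (frac (1/x))\<bar>"
    using q by (simp add: abs_mult)
  also have "\<dots> \<le> 2 * (1/16) * M"
    using q d by (intro mult_mono) auto
  finally show ?thesis by simp
qed

lemma interrobang_op_contracts:
  assumes "\<And>y. y \<in> {0..1} \<Longrightarrow> \<bar>f y - g y\<bar> \<le> M" and "x \<in> {0..1}"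
  shows "\<bar>interrobang_op f x - interrobang_op g x\<bar> \<le> 13/16 * M"
proof -
  have M: "0 \<le> M" using assms(1)[of 0] by simp
  show ?thesis
  proof (cases "x \<le> 1/2")
    case True
    then show ?thesis
      using lower_branch_contracts[of f g M x] assms M by (simp add: interrobang_op_def)
  next
    case False
    have "1/x - 1 \<in> {0..1}" using False assms(2) by (auto simp: field_simps)
    then have 1: "\<bar>f (1/x - 1) - g (1/x - 1)\<bar> \<le> M" by (rule assms(1))
    have 2: "\<bar>lower_branch f (1 - x) - lower_branch g (1 - x)\<bar> \<le> M / 8"
      using assms(2) False by (intro lower_branch_contracts assms(1)) auto
    have "interrobang_op f x - interrobang_op g x = - 3/4 * (f (1/x - 1) - g (1/x - 1))
        - 1/2 * (lower_branch f (1 - x) - lower_branch g (1 - x))"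
      using False by (simp add: interrobang_op_def algebra_simps)
    then show ?thesis using 1 2 unfolding abs_le_iff by argo
  qed
qed

lemma interrobang_eqs_lower_branch:
  assumes "interrobang_eqs f" "0 \<le> x" "x \<le> 1/2"
  shows "f x = lower_branch f x"
  using assms by (auto simp: interrobang_eqs_def lower_branch_def)

text \<open>For \<open>x > 1/2\<close> the point \<open>1 - x\<close> lies in the lower half, where
  being fixed is the second equation itself; so the substitution made in
  \<open>interrobang_op\<close> can be undone.\<close>

lemma interrobang_eqs_iff_fixpoint:
  "interrobang_eqs f \<longleftrightarrow> (\<forall>x\<in>{0..1}. interrobang_op f x = f x)"
proof
  assume f: "interrobang_eqs f"
  show "\<forall>x\<in>{0..1}. interrobang_op f x = f x"
  proof
    fix x :: real assume x: "x \<in> {0..1}"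
    show "interrobang_op f x = f x"
    proof (cases "x \<le> 1/2")
      case True
      then show ?thesis using interrobang_eqs_lower_branch[OF f, of x] x by (simp add: interrobang_op_def)
    next
      case False
      then have "f x = 3/8 - 3/4 * f (1/x - 1) - 1/2 * f (1 - x)"
        using f x by (auto simp: interrobang_eqs_def)
      then show ?thesis using interrobang_eqs_lower_branch[OF f, of "1 - x"] x False
        by (simp add: interrobang_op_def)
    qed
  qed
next
  assume *: "\<forall>x\<in>{0..1}. interrobang_op f x = f x"
  have low: "f x = lower_branch f x" if "0 \<le> x" "x \<le> 1/2" for x
    using *[rule_format, of x] that by (simp add: interrobang_op_def)
  have "f 0 = 0" using low[of 0] by (simp add: lower_branch_def)
  moreover have "f x = (1/4) ^ nat \<lfloor>1/x\<rfloor> * (1 - 2 * f (frac (1/x)))" if "0 < x" "x \<le> 1/2" for x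
    using low[of x] that by (simp add: lower_branch_def)
  moreover have "f x = 3/8 - 3/4 * f (1/x - 1) - 1/2 * f (1 - x)" if "1/2 < x" "x \<le> 1" for x
    using *[rule_format, of x] that low[of "1 - x"] by (simp add: interrobang_op_def)
  ultimately show "interrobang_eqs f" unfolding interrobang_eqs_def by blast
qed

section \<open>Invariance of the admissible class\<close>

text \<open>At \<open>1/x = n + 1\<close> the floor has already jumped, but
  \<open>1 - 2 * 3/8 = 1/4\<close> makes the formula with \<open>n\<close> agree with the one with
  \<open>n + 1\<close>. Both endpoints may thus be included, and the closed pieces can be
  glued.\<close>

lemma lower_branch_piece:
  assumes "f 0 = 0" "f 1 = 3/8" "0 < x" "real n \<le> 1/x" "1/x \<le> real n + 1"
  shows "lower_branch f x = (1/4) ^ n * (1 - 2 * f (1/x - real n))"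
proof (cases "1/x = real n + 1")
  case True
  then have "\<lfloor>1/x\<rfloor> = int (Suc n)" by linarith
  then have "lower_branch f x = (1/4) ^ Suc n * (1 - 2 * f 0)"
    using True assms by (simp add: lower_branch_def frac_def nat_add_distrib)
  then show ?thesis unfolding True using assms(1) by (simp add: assms(2))
next
  case False
  then have "\<lfloor>1/x\<rfloor> = int n" using assms by linarith
  then show ?thesis using assms by (simp add: lower_branch_def frac_def)
qed

lemma continuous_on_lower_branch_piece:
  assumes "admissible f" "1 \<le> n"
  shows "continuous_on {1/(real n + 1)..1/real n} (lower_branch f)"
proof -
  have x: "0 < x" "real n \<le> 1/x" "1/x \<le> real n + 1" if "x \<in> {1/(real n + 1)..1/real n}" for x
  proof -
    have "0 < 1/(real n + 1)" by simp
    then show "0 < x" using that by (meson atLeastAtMost_iff less_le_trans)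
    then show "real n \<le> 1/x" "1/x \<le> real n + 1" using that assms(2) by (auto simp: field_simps)
  qed
  have cont: "continuous_on {0..1} f" using assms(1) by (simp add: admissible_def)
  have "continuous_on {1/(real n + 1)..1/real n} (\<lambda>x. (1/4) ^ n * (1 - 2 * f (1/x - real n)))"
  proof (intro continuous_intros continuous_on_compose2[OF cont])
    show "\<forall>x\<in>{1/(real n + 1)..1/real n}. x \<noteq> 0" using x(1) by (metis less_irrefl)
    show "(\<lambda>x. 1/x - real n) ` {1/(real n + 1)..1/real n} \<subseteq> {0..1}"
      using x(2,3) by (simp add: image_subset_iff algebra_simps)
  qed
  then show ?thesis
  proof (rule continuous_on_eq)
    fix x assume "x \<in> {1/(real n + 1)..1/real n}"
    then show "(1/4) ^ n * (1 - 2 * f (1/x - real n)) = lower_branch f x"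
      using lower_branch_piece[of f x n] x[of x] assms(1) by (simp add: admissible_def)
  qed
qed

lemma continuous_on_lower_branch_away_from_0:
  assumes "admissible f" "1 \<le> n"
  shows "continuous_on {1/real n..1} (lower_branch f)"
  using assms(2)
proof (induction n rule: nat_induct_at_least)
  case base
  then show ?case by simp
next
  case (Suc n)
  have "1/(real n + 1) \<le> 1/real n" "1/real n \<le> 1" using Suc(1) by (auto simp: field_simps)
  then have "{1/real (Suc n)..1} = {1/(real n + 1)..1/real n} \<union> {1/real n..1}"
    by (auto simp: add.commute)
  then show ?case
    using continuous_on_closed_Un[OF _ _ continuous_on_lower_branch_piece[OF assms(1) Suc(1)] Suc(2)]
    by simp
qed

text \<open>Since \<open>0 \<le> f \<le> 3/8\<close>, the factor \<open>1 - 2 * f\<close> lies in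
  \<open>[1/4, 1]\<close>. The ranges for different floors therefore overlap at most in
  endpoints.\<close>

lemma lower_branch_bounds:
  assumes "admissible f" "0 < x"
  shows "(1/4) ^ (nat \<lfloor>1/x\<rfloor> + 1) \<le> lower_branch f x" "lower_branch f x \<le> (1/4) ^ nat \<lfloor>1/x\<rfloor>"
  using admissible_bounds[OF assms(1) frac_unit_interval, of "1/x"] assms(2)
  by (auto simp: lower_branch_def)

lemma lower_branch_nonneg: "admissible f \<Longrightarrow> 0 \<le> x \<Longrightarrow> 0 \<le> lower_branch f x"
  using lower_branch_bounds(1)[of f x]
  by (cases "x = 0") (auto simp: lower_branch_def intro: order_trans[rotated])

lemma continuous_on_lower_branch:
  assumes "admissible f"
  shows "continuous_on {0..1} (lower_branch f)"
  unfolding continuous_on_eq_continuous_within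
proof
  fix x :: real assume x: "x \<in> {0..1}"
  show "continuous (at x within {0..1}) (lower_branch f)"
  proof (cases "x = 0")
    case True
    \<comment> \<open>At \<open>0\<close> infinitely many pieces accumulate, so gluing is replaced
      by a squeeze between \<open>0\<close> and this power.\<close>
    have "((\<lambda>x::real. (1/4) ^ nat \<lfloor>1/x\<rfloor>) \<longlongrightarrow> (0::real)) (at_right 0)"
    proof (rule filterlim_compose[OF LIMSEQ_realpow_zero])
      show "filterlim (\<lambda>x::real. nat \<lfloor>1/x\<rfloor>) sequentially (at_right 0)"
        unfolding filterlim_at_top
      proof
        fix N :: nat
        have "\<forall>\<^sub>F x::real in at_right 0. x < 1 / (real N + 1)"
          by (rule eventually_at_right_real[THEN eventually_mono]) auto
        moreover have "\<forall>\<^sub>F x::real in at_right 0. 0 < x"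
          by (rule eventually_at_right_less)
        ultimately show "\<forall>\<^sub>F x::real in at_right 0. N \<le> nat \<lfloor>1/x\<rfloor>"
        proof eventually_elim
          case (elim x)
          then have "real N \<le> 1/x" by (simp add: field_simps)
          then show ?case by linarith
        qed
      qed
    qed auto
    then have "(lower_branch f \<longlongrightarrow> 0) (at_right 0)"
    proof (rule tendsto_sandwich[OF _ _ tendsto_const, rotated 2])
      show "\<forall>\<^sub>F x in at_right 0. 0 \<le> lower_branch f x"
        using eventually_at_right_less[of 0] by eventually_elim (simp add: lower_branch_nonneg assms)
      show "\<forall>\<^sub>F x in at_right 0. lower_branch f x \<le> (1/4) ^ nat \<lfloor>1/x\<rfloor>"
        using eventually_at_right_less[of 0] by eventually_elim (rule lower_branch_bounds[OF assms])
    qed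
    then show ?thesis using True
      by (simp add: continuous_within lower_branch_def at_within_Icc_at_right)
  next
    case False
    then have "0 < x" using x by simp
    then obtain n :: nat where n: "1/x < real n" using reals_Archimedean2 by blast
    then have "0 < real n" using \<open>0 < x\<close> by (meson divide_pos_pos less_trans zero_less_one)
    then have n1: "1 \<le> n" "1/real n < x" using n \<open>0 < x\<close> by (auto simp: field_simps)
    have "continuous (at x within {1/real n..1}) (lower_branch f)"
      using continuous_on_lower_branch_away_from_0[OF assms n1(1)] n1(2) x
      by (simp add: continuous_on_eq_continuous_within)
    moreover have "at x within {1/real n..1} = at x within {0..1}"
    proof (rule at_within_nhd[of x "{1/real n<..}"])
      show "{1/real n..1} \<inter> {1/real n<..} - {x} = {0..1} \<inter> {1/real n<..} - {x}"
        using order_trans[OF _ less_imp_le, of 0 "1/real n"] by auto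
    qed (use n1 in auto)
    ultimately show ?thesis by simp
  qed
qed

lemma mono_on_lower_branch:
  assumes "admissible f"
  shows "mono_on {0..1} (lower_branch f)"
proof (rule mono_onI)
  fix x y :: real assume xy: "x \<in> {0..1}" "y \<in> {0..1}" "x \<le> y"
  show "lower_branch f x \<le> lower_branch f y"
  proof (cases "x = 0")
    case True
    then show ?thesis using lower_branch_nonneg[OF assms, of y] xy by (simp add: lower_branch_def)
  next
    case False
    then have pos: "0 < x" "0 < y" using xy by auto
    then have inv: "1/y \<le> 1/x" using xy by (simp add: field_simps)
    show ?thesis
    proof (cases "\<lfloor>1/x\<rfloor> = \<lfloor>1/y\<rfloor>")
      case True
      \<comment> \<open>Within one piece, both \<open>frac (1/x)\<close> as a function of
        \<open>x\<close> and \<open>1 - 2 * f\<close> reverse the order, so their composition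
        preserves it.\<close>
      then have "frac (1/y) \<le> frac (1/x)" using inv by (simp add: frac_def)
      then have "f (frac (1/y)) \<le> f (frac (1/x))"
        using assms frac_unit_interval mono_onD[of "{0..1}" f] unfolding admissible_def by blast
      then show ?thesis using pos True by (simp add: lower_branch_def)
    next
      case False
      then have "\<lfloor>1/y\<rfloor> < \<lfloor>1/x\<rfloor>" using floor_mono[OF inv] by linarith
      moreover have "0 \<le> \<lfloor>1/y\<rfloor>" using pos by simp
      ultimately have "nat \<lfloor>1/y\<rfloor> + 1 \<le> nat \<lfloor>1/x\<rfloor>" by linarith
      then have "(1/4::real) ^ nat \<lfloor>1/x\<rfloor> \<le> (1/4) ^ (nat \<lfloor>1/y\<rfloor> + 1)"
        by (intro power_decreasing) auto
      then show ?thesis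
        using lower_branch_bounds[OF assms pos(1)] lower_branch_bounds[OF assms pos(2)] by linarith
    qed
  qed
qed

lemma admissible_interrobang_op:
  assumes "admissible f"
  shows "admissible (interrobang_op f)"
proof -
  have f: "continuous_on {0..1} f" "mono_on {0..1} f" "f 0 = 0" "f 1 = 3/8"
    using assms by (auto simp: admissible_def)
  define u where "u x = 3/8 - 3/4 * f (1/x - 1) - 1/2 * lower_branch f (1 - x)" for x
  \<comment> \<open>The two branches meet at \<open>1/2\<close>:
    \<open>3/8 - 3/4 * 3/8 - 1/2 * 1/16 = 1/16\<close>.\<close>
  have half: "lower_branch f (1/2) = 1/16"
    using f by (simp add: lower_branch_def power2_eq_square frac_def)
  then have u_half: "u (1/2) = 1/16" using f by (simp add: u_def)
  have dom: "1/x - 1 \<in> {0..1}" "1 - x \<in> {0..1}" if "x \<in> {1/2..1}" for x :: real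
    using that by (auto simp: field_simps)
  have cu: "continuous_on {1/2..1} u"
    unfolding u_def
  proof (intro continuous_intros continuous_on_compose2[OF f(1)]
      continuous_on_compose2[OF continuous_on_lower_branch[OF assms]])
    show "(\<lambda>x. 1/x - 1) ` {1/2..1} \<subseteq> {0..1::real}" using dom(1) by blast
    show "(-) 1 ` {1/2..1} \<subseteq> {0..1::real}" using dom(2) by blast
  qed auto
  have mu: "u x \<le> u y" if "x \<in> {1/2..1}" "y \<in> {1/2..1}" "x \<le> y" for x y
  proof -
    have "1/y - 1 \<le> 1/x - 1" using that by (simp add: field_simps)
    then have "f (1/y - 1) \<le> f (1/x - 1)" using mono_onD[OF f(2)] dom that by blast
    moreover have "lower_branch f (1 - y) \<le> lower_branch f (1 - x)"
      using mono_onD[OF mono_on_lower_branch[OF assms] dom(2) dom(2)] that by simp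
    ultimately show ?thesis unfolding u_def by linarith
  qed
  have op: "interrobang_op f x = (if x \<le> 1/2 then lower_branch f x else u x)" for x
    by (simp add: interrobang_op_def u_def)
  have "continuous_on ({0..1/2} \<union> {1/2..1}) (\<lambda>x. if x \<le> 1/2 then lower_branch f x else u x)"
  proof (rule continuous_on_If)
    show "continuous_on {0..1/2} (lower_branch f)"
      by (rule continuous_on_subset[OF continuous_on_lower_branch[OF assms]]) auto
    show "lower_branch f x = u x" if "x \<in> {1/2..1}" "x \<le> 1/2" for x
    proof -
      have "x = 1/2" using that by simp
      then show ?thesis by (simp only: half u_half)
    qed
  qed (use cu in auto)
  moreover have "{0..1/2} \<union> {1/2..1} = {0..1::real}" by auto
  ultimately have "continuous_on {0..1} (interrobang_op f)"
    by (simp add: op[abs_def])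
  moreover have "mono_on {0..1} (interrobang_op f)"
  proof (rule mono_onI)
    fix x y :: real assume xy: "x \<in> {0..1}" "y \<in> {0..1}" "x \<le> y"
    have lm: "lower_branch f x \<le> lower_branch f y" if "x \<in> {0..1}" "y \<in> {0..1}" "x \<le> y" for x y
      using mono_onD[OF mono_on_lower_branch[OF assms] that] .
    consider "y \<le> 1/2" | "x \<le> 1/2" "1/2 < y" | "1/2 < x" by linarith
    then show "interrobang_op f x \<le> interrobang_op f y"
    proof cases
      case 1
      then show ?thesis using lm[of x y] xy by (simp add: op)
    next
      case 2
      then show ?thesis using lm[of x "1/2"] mu[of "1/2" y] half u_half xy by (simp add: op)
    next
      case 3
      then show ?thesis using mu[of x y] xy by (simp add: op)
    qed
  qed
  moreover have "interrobang_op f 0 = 0" "interrobang_op f 1 = 3/8"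
    using f by (auto simp: interrobang_op_def lower_branch_def)
  ultimately show ?thesis by (simp add: admissible_def)
qed

section \<open>Existence and strict monotonicity of the fixed point\<close>

lemma admissible_fixpoint_exists:
  obtains f where "admissible f" "interrobang_eqs f"
proof -
  \<comment> \<open>The iteration starts from the linear function with the required values at
    \<open>0\<close> and \<open>1\<close>, so every iterate is admissible.\<close>
  define F where "F n = (interrobang_op ^^ n) (\<lambda>x. 3/8 * x)" for n
  have F_Suc: "F (Suc n) = interrobang_op (F n)" for n by (simp add: F_def)
  have adm: "admissible (F n)" for n
  proof (induction n)
    case 0
    show ?case by (auto simp: F_def admissible_def mono_on_def intro!: continuous_intros)
  qed (simp add: F_Suc admissible_interrobang_op)
  have step: "\<bar>F (Suc n) x - F n x\<bar> \<le> (13/16) ^ n" if "x \<in> {0..1}" for n x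
    using that
  proof (induction n arbitrary: x)
    case 0
    then show ?case
      using admissible_bounds[OF adm[of 0] 0] admissible_bounds[OF adm[of 1] 0] by simp
  next
    case (Suc n)
    then show ?case
      using interrobang_op_contracts[of "F (Suc n)" "F n" "(13/16) ^ n" x] by (simp add: F_Suc)
  qed
  \<comment> \<open>The limit is written as a telescoping series so that the geometric bound
    \<open>step\<close> feeds the Weierstrass M-test.\<close>
  define f where "f x = F 0 x + (\<Sum>n. F (Suc n) x - F n x)" for x
  have "uniform_limit {0..1} (\<lambda>n x. \<Sum>i<n. F (Suc i) x - F i x)
          (\<lambda>x. \<Sum>i. F (Suc i) x - F i x) sequentially"
    by (rule Weierstrass_m_test[of _ _ "\<lambda>n. (13/16) ^ n"]) (use step in \<open>auto intro: summable_geometric\<close>)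
  then have "uniform_limit {0..1} (\<lambda>n x. F 0 x + (\<Sum>i<n. F (Suc i) x - F i x)) f sequentially"
    unfolding f_def by (intro uniform_limit_intros)
  moreover have "F 0 x + (\<Sum>i<n. F (Suc i) x - F i x) = F n x" for n x
    using sum_lessThan_telescope[of "\<lambda>i. F i x" n] by simp
  ultimately have ul: "uniform_limit {0..1} F f sequentially" by simp
  have lim: "(\<lambda>n. F n x) \<longlonglongrightarrow> f x" if "x \<in> {0..1}" for x
    using tendsto_uniform_limitI[OF ul that] .
  have "continuous_on {0..1} f"
    by (rule uniform_limit_theorem[OF _ ul]) (use adm in \<open>auto simp: admissible_def\<close>)
  moreover have "mono_on {0..1} f"
  proof (rule mono_onI)
    fix x y :: real assume xy: "x \<in> {0..1}" "y \<in> {0..1}" "x \<le> y"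
    show "f x \<le> f y"
    proof (rule LIMSEQ_le[OF lim lim])
      show "\<exists>N. \<forall>n\<ge>N. F n x \<le> F n y"
        using adm xy mono_onD[of "{0..1}" "F _" x y] by (auto simp: admissible_def)
    qed (use xy in auto)
  qed
  moreover have "F n 0 = 0" "F n 1 = 3/8" for n using adm by (auto simp: admissible_def)
  then have "f 0 = 0" "f 1 = 3/8"
    using lim[of 0] lim[of 1] by (simp_all only: LIMSEQ_const_iff) auto
  ultimately have "admissible f" by (simp add: admissible_def)
  moreover have "interrobang_eqs f"
    unfolding interrobang_eqs_iff_fixpoint
  proof
    fix x :: real assume x: "x \<in> {0..1}"
    have low: "(\<lambda>n. lower_branch (F n) z) \<longlonglongrightarrow> lower_branch f z" for z
      unfolding lower_branch_def using lim[OF frac_unit_interval] by (auto intro!: tendsto_intros)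
    have "(\<lambda>n. interrobang_op (F n) x) \<longlonglongrightarrow> interrobang_op f x"
    proof (cases "x \<le> 1/2")
      case True
      then show ?thesis using low by (simp add: interrobang_op_def)
    next
      case False
      then have "1/x - 1 \<in> {0..1}" using x by (auto simp: field_simps)
      then show ?thesis using False low lim by (auto simp: interrobang_op_def intro!: tendsto_intros)
    qed
    moreover have "(\<lambda>n. interrobang_op (F n) x) \<longlonglongrightarrow> f x"
      using LIMSEQ_Suc[OF lim[OF x]] by (simp add: F_Suc)
    ultimately show "interrobang_op f x = f x" by (rule LIMSEQ_unique)
  qed
  ultimately show ?thesis by (rule that)
qed

text \<open>A maximal interval of constancy would be mapped to a longer one by some \<open>x \<mapsto> 1/x - n\<close>.\<close>
lemma admissible_fixpoint_strict_mono:
  assumes adm: "admissible f" and eqs: "interrobang_eqs f"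
  shows "strict_mono_on {0..1} f"
proof -
  have f: "continuous_on {0..1} f" "mono_on {0..1} f" "f 0 = 0" "f 1 = 3/8"
    using adm by (auto simp: admissible_def)
  have mono: "f x \<le> f y" if "0 \<le> x" "x \<le> y" "y \<le> 1" for x y
    using mono_onD[OF f(2), of x y] that by simp
  have low: "f x = lower_branch f x" if "0 \<le> x" "x \<le> 1/2" for x
    using interrobang_eqs_lower_branch[OF eqs] that by simp
  have half: "f (1/2) = 1/16" using low[of "1/2"] f by (simp add: lower_branch_def power2_eq_square frac_def)
  \<comment> \<open>The third equation also holds at \<open>1/2\<close>, where the definition
    prescribes only the second; this allows closed pieces below.\<close>
  have upper: "f x = 3/8 - 3/4 * f (1/x - 1) - 1/2 * f (1 - x)" if "1/2 \<le> x" "x \<le> 1" for x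
  proof (cases "x = 1/2")
    case True
    show ?thesis unfolding True by (simp add: half f(4))
  next
    case False
    then show ?thesis using eqs that by (simp add: interrobang_eqs_def)
  qed
  have pos: "0 < f x" if "0 < x" "x \<le> 1" for x
  proof (cases "x \<le> 1/2")
    case True
    have "0 < (1/4::real) ^ (nat \<lfloor>1/x\<rfloor> + 1)" by simp
    then show ?thesis using low[of x] lower_branch_bounds(1)[OF adm that(1)] True that by linarith
  next
    case False
    then show ?thesis using mono[of "1/2" x] half that by simp
  qed
  have lt: "f x < 3/8" if "0 \<le> x" "x < 1" for x
  proof (cases "x \<le> 1/2")
    case True
    then show ?thesis using mono[of x "1/2"] half that by simp
  next
    case False
    have "0 < 1/x - 1" "1/x - 1 \<le> 1" using that False by (auto simp: field_simps)
    then show ?thesis using upper[of x] pos[of "1/x - 1"] pos[of "1 - x"] False that by simp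
  qed
  \<comment> \<open>Equality of two values inside one closed piece passes to the images of the
    points under \<open>1/x - n\<close>.\<close>
  have piece: "f (1/x - real n) = f (1/y - real n)"
    if "1 \<le> n" "x \<le> y" "0 < x" "real n \<le> 1/y" "1/x \<le> real n + 1" "f x = f y" for x y n
  proof -
    have y: "0 < y" and inv: "1/y \<le> 1/x" using that by (auto simp: field_simps)
    show ?thesis
    proof (cases "n = 1")
      case True
      have xy: "1/2 \<le> x" "y \<le> 1" using that True y by (auto simp: field_simps)
      \<comment> \<open>Both subtracted terms decrease weakly from \<open>x\<close> to
        \<open>y\<close>; as the totals agree, each term must stay the same.\<close>
      have "f (1/y - 1) \<le> f (1/x - 1)" using that True inv by (intro mono) auto
      moreover have "f (1 - y) \<le> f (1 - x)" using that xy y by (intro mono) auto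
      ultimately show ?thesis using upper[of x] upper[of y] xy that True by simp
    next
      case False
      then have "2 \<le> real n" using that by simp
      then have "2 \<le> 1/y" using that(4) by linarith
      then have "y \<le> 1/2" using y by (simp add: field_simps)
      then have "lower_branch f x = lower_branch f y" using low that y by auto
      then show ?thesis
        using lower_branch_piece[OF f(3,4), of x n] lower_branch_piece[OF f(3,4), of y n] that y inv by simp
    qed
  qed
  \<comment> \<open>Compactness of the set of pairs with equal values provides a pair of maximal
    signed distance.\<close>
  define Z where "Z = {p \<in> {0..1} \<times> {0..1}. f (fst p) - f (snd p) = 0}"
  have "continuous_on ({0..1} \<times> {0..1}) (\<lambda>p. f (fst p) - f (snd p))"
    by (intro continuous_intros continuous_on_compose2[OF f(1)]) auto
  then have "closed Z"
    unfolding Z_def by (intro continuous_closed_preimage_constant) (auto intro: closed_Times)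
  then have "compact (({0..1} \<times> {0..1}) \<inter> Z)" by (intro compact_Int_closed compact_Times) auto
  moreover have "({0..1} \<times> {0..1}) \<inter> Z = Z" by (auto simp: Z_def)
  ultimately have "compact Z" by simp
  moreover have "(0, 0) \<in> Z" by (simp add: Z_def)
  moreover have "continuous_on Z (\<lambda>p. snd p - fst p)" by (intro continuous_intros)
  ultimately obtain p where p: "p \<in> Z" "\<And>q. q \<in> Z \<Longrightarrow> snd q - fst q \<le> snd p - fst p"
    using continuous_attains_sup[of Z "\<lambda>p. snd p - fst p"] by blast
  obtain x y where [simp]: "p = (x, y)" by (cases p)
  have xy: "0 \<le> x" "x \<le> 1" "0 \<le> y" "y \<le> 1" "f x = f y" using p(1) by (auto simp: Z_def)
  have max: "b - a \<le> y - x" if "0 \<le> a" "a \<le> 1" "0 \<le> b" "b \<le> 1" "f a = f b" for a b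
    using p(2)[of "(a, b)"] that by (simp add: Z_def)
  have "y \<le> x"
  proof (rule ccontr)
    assume "\<not> y \<le> x"
    then have "x < y" by simp
    have "0 < x" using xy pos[of y] \<open>x < y\<close> f(3) by (cases "x = 0") auto
    have "0 < y" using \<open>x < y\<close> \<open>0 < x\<close> by simp
    define n where "n = nat \<lfloor>1/y\<rfloor>"
    have "1 \<le> 1/y" using xy \<open>0 < y\<close> by simp
    then have n: "1 \<le> n" "real n \<le> 1/y" "1/y < real n + 1" unfolding n_def by linarith+
    show False
    proof (cases "1/x \<le> real n + 1")
      case True
      \<comment> \<open>If both ends lie in one piece, inversion stretches their distance by
        \<open>1/(x * y) > 1\<close>, against maximality.\<close>
      have inv: "1/y < 1/x" using \<open>x < y\<close> \<open>0 < x\<close> by (simp add: field_simps)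
      have "f (1/y - real n) = f (1/x - real n)"
        using piece[of n x y] n True \<open>x < y\<close> \<open>0 < x\<close> xy by simp
      then have "1/x - 1/y \<le> y - x"
        using max[of "1/y - real n" "1/x - real n"] n True inv by simp
      moreover have "1/x - 1/y = (y - x) / (x * y)"
        using \<open>0 < x\<close> \<open>0 < y\<close> by (simp add: field_simps)
      moreover have "x * y < 1"
        using mult_left_le[of y x] \<open>x < y\<close> xy by linarith
      then have "y - x < (y - x) / (x * y)"
        using \<open>0 < x\<close> \<open>0 < y\<close> \<open>x < y\<close> mult_strict_left_mono[of "x * y" 1 "y - x"]
        by (simp add: less_divide_eq)
      ultimately show False by linarith
    next
      case False
      \<comment> \<open>Otherwise the interval contains the left end \<open>z\<close> of the piece
        of \<open>y\<close>. Since \<open>1/z - n = 1\<close>, the value \<open>f 1\<close> would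
        also be taken at a point below \<open>1\<close>.\<close>
      define z where "z = 1 / (real n + 1)"
      have z: "x \<le> z" "z \<le> y" "0 < z" "1/z = real n + 1"
        using False n \<open>0 < x\<close> \<open>0 < y\<close> by (auto simp: z_def field_simps)
      then have "f z = f y" using mono[of x z] mono[of z y] xy by simp
      then have "f 1 = f (1/y - real n)" using piece[of n z y] n z by simp
      then show False using lt[of "1/y - real n"] n f by simp
    qed
  qed
  then have inj: "a = b" if "0 \<le> a" "a \<le> b" "b \<le> 1" "f a = f b" for a b
    using max[of a b] that by simp
  show ?thesis
  proof (rule strict_mono_onI)
    fix a b :: real assume "a \<in> {0..1}" "b \<in> {0..1}" "a < b"
    then show "f a < f b" using mono[of a b] inj[of a b] by fastforce
  qed
qed

section \<open>Uniqueness, and the defining equations for \<open>interrobang\<close>\<close>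

text \<open>Where \<open>\<bar>f - g\<bar>\<close> is maximal, the contraction bounds the maximum by
  \<open>13/16\<close> of itself.\<close>

lemma continuous_interrobang_eqs_unique:
  assumes "continuous_on {0..1} f" "interrobang_eqs f"
    and "continuous_on {0..1} g" "interrobang_eqs g" and "x \<in> {0..1}"
  shows "f x = g x"
proof -
  have "continuous_on {0..1} (\<lambda>x. \<bar>f x - g x\<bar>)" by (intro continuous_intros assms)
  then obtain z where z: "z \<in> {0..1}" "\<And>y. y \<in> {0..1} \<Longrightarrow> \<bar>f y - g y\<bar> \<le> \<bar>f z - g z\<bar>"
    using continuous_attains_sup[of "{0..1::real}" "\<lambda>x. \<bar>f x - g x\<bar>"] by auto
  have "\<bar>f z - g z\<bar> \<le> 13/16 * \<bar>f z - g z\<bar>"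
    using interrobang_op_contracts[of f g "\<bar>f z - g z\<bar>" z] z assms(2,4)
    by (simp add: interrobang_eqs_iff_fixpoint)
  then have "\<bar>f x - g x\<bar> \<le> 0" using z(2)[OF assms(5)] by argo
  then show ?thesis by simp
qed

text \<open>Existence and uniqueness show that the definite description denotes; the arithmetic part
  relies on these equations alone.\<close>

lemma interrobang_eqs_interrobang: "interrobang_eqs interrobang"
proof -
  let ?P = "\<lambda>f. continuous_on {0..1} f \<and> strict_mono_on {0..1} f \<and>
                 interrobang_eqs f \<and> (\<forall>x. x \<notin> {0..1} \<longrightarrow> f x = 0)"
  obtain f where f: "admissible f" "interrobang_eqs f" by (rule admissible_fixpoint_exists)
  define g where "g x = (if x \<in> {0..1} then f x else 0)" for x
  have fg: "g x = f x" if "x \<in> {0..1}" for x using that by (simp add: g_def)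
  have "continuous_on {0..1} g"
    by (rule continuous_on_eq[of _ f]) (use f(1) fg in \<open>auto simp: admissible_def\<close>)
  moreover have "strict_mono_on {0..1} g"
    using admissible_fixpoint_strict_mono[OF f] fg by (simp add: strict_mono_on_def)
  moreover have "interrobang_eqs g"
    unfolding interrobang_eqs_iff_fixpoint
  proof
    fix x :: real assume x: "x \<in> {0..1}"
    \<comment> \<open>Contraction with \<open>M = 0\<close>: on the unit interval the operator only
      sees values on the unit interval, so the cut-off is harmless.\<close>
    have "\<bar>interrobang_op g x - interrobang_op f x\<bar> \<le> 13/16 * 0"
      by (rule interrobang_op_contracts) (use x fg in auto)
    then show "interrobang_op g x = g x"
      using f(2) x fg by (simp add: interrobang_eqs_iff_fixpoint)
  qed
  ultimately have P: "?P g" by (simp add: g_def)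
  have "h = g" if "?P h" for h
  proof
    fix x
    show "h x = g x"
      using that P continuous_interrobang_eqs_unique[of h g x] by (cases "x \<in> {0..1}") auto
  qed
  then have "?P (THE f. ?P f)" using P by (rule theI[of ?P, rotated])
  then show ?thesis unfolding interrobang_def by blast
qed

section \<open>The recursion along Gauss orbits\<close>

lemma gauss_map_irrational: "x \<notin> \<rat> \<Longrightarrow> gauss_map x \<notin> \<rat>"
proof
  assume x: "x \<notin> \<rat>" and "gauss_map x \<in> \<rat>"
  then have "of_int \<lfloor>1/x\<rfloor> + gauss_map x \<in> \<rat>" by simp
  then have "1/x \<in> \<rat>" by (simp add: gauss_map_def frac_def)
  then have "1/(1/x) \<in> \<rat>" by (rule Rats_divide[OF Rats_1])
  then show False using x by simp
qed

lemma gauss_map_unit: "x \<notin> \<rat> \<Longrightarrow> gauss_map x \<in> {0<..<1}"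
  using gauss_map_irrational[of x] frac_lt_1[of "1/x"] frac_ge_0[of "1/x"] Ints_subset_Rats
  by (auto simp: gauss_map_def)

text \<open>For \<open>x > 1/2\<close> the point \<open>1 - x\<close> has the same second Gauss iterate as \<open>x\<close>, because
  \<open>1/(1 - x) = 1 + 1/(1/x - 1)\<close>.\<close>
lemma interrobang_eqs_gauss_recursion:
  assumes f: "interrobang_eqs f" and x: "0 < x" "x < 1" "x \<notin> \<rat>"
  obtains a b c :: rat where "\<bar>a\<bar> + \<bar>b\<bar> \<le> 13/16"
    "f x = of_rat c + of_rat a * f (gauss_map x) + of_rat b * f (gauss_map (gauss_map x))"
proof (cases "x \<le> 1/2")
  case True
  define n where "n = nat \<lfloor>1/x\<rfloor>"
  have n: "2 \<le> n" unfolding n_def using two_le_floor_inverse x True by blast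
  show ?thesis
  proof (rule that[of "- 2 * (1/4) ^ n" 0 "(1/4) ^ n"])
    have "(1/4::rat) ^ n \<le> (1/4) ^ 2" using n by (intro power_decreasing) auto
    then show "\<bar>- 2 * (1/4) ^ n\<bar> + \<bar>0\<bar> \<le> (13/16::rat)"
      by (simp add: abs_mult power2_eq_square)
    have "f x = (1/4) ^ n * (1 - 2 * f (gauss_map x))"
      using f x True by (simp add: interrobang_eqs_def n_def gauss_map_def)
    then show "f x = of_rat ((1/4) ^ n) + of_rat (- 2 * (1/4) ^ n) * f (gauss_map x) +
        of_rat 0 * f (gauss_map (gauss_map x))"
      by (simp add: of_rat_mult of_rat_power of_rat_divide of_rat_minus algebra_simps)
  qed
next
  case False
  have "\<lfloor>1/x\<rfloor> = 1" using x False by (simp add: floor_eq_iff field_simps)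
  then have t: "gauss_map x = 1/x - 1" by (simp add: gauss_map_def frac_def)
  have "gauss_map x \<in> {0<..<1}" using gauss_map_unit[OF x(3)] .
  then have "1 < 1 / gauss_map x" by simp
  moreover have inv: "1/(1 - x) = 1 / gauss_map x + 1"
    using x by (simp add: t field_simps)
  ultimately have "2 \<le> 1/(1 - x)" by simp
  then have fl: "2 \<le> nat \<lfloor>1/(1 - x)\<rfloor>" by linarith
  have fr: "frac (1/(1 - x)) = gauss_map (gauss_map x)"
    unfolding inv by (simp add: gauss_map_def frac_def)
  define n where "n = nat \<lfloor>1/(1 - x)\<rfloor>"
  have n: "2 \<le> n" using fl by (simp add: n_def)
  show ?thesis
  \<comment> \<open>The last coefficient is \<open>-1/2\<close> times \<open>-2 * (1/4) ^ n\<close>;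
    as \<open>n \<ge> 2\<close>, it is at most \<open>1/16\<close>.\<close>
  proof (rule that[of "- 3/4" "(1/4) ^ n" "3/8 - 1/2 * (1/4) ^ n"])
    have "(1/4::rat) ^ n \<le> (1/4) ^ 2" using n by (intro power_decreasing) auto
    then show "\<bar>- 3/4\<bar> + \<bar>(1/4) ^ n\<bar> \<le> (13/16::rat)" by (simp add: power2_eq_square)
    have "f (1 - x) = (1/4) ^ n * (1 - 2 * f (gauss_map (gauss_map x)))"
      using f x False fr by (simp add: interrobang_eqs_def n_def)
    moreover have "f x = 3/8 - 3/4 * f (gauss_map x) - 1/2 * f (1 - x)"
      using f x False t by (simp add: interrobang_eqs_def)
    ultimately show "f x = of_rat (3/8 - 1/2 * (1/4) ^ n) + of_rat (- 3/4) * f (gauss_map x) +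
        of_rat ((1/4) ^ n) * f (gauss_map (gauss_map x))"
      by (simp add: of_rat_mult of_rat_power of_rat_divide of_rat_minus of_rat_diff algebra_simps)
  qed
qed

section \<open>Conjugates and finiteness of Gauss orbits\<close>

text \<open>Vieta's formulas for the two roots of an integer polynomial
  \<open>a X^2 + b X + c\<close> of discriminant \<open>D\<close>. Only \<open>D\<close> is kept as
  a parameter, since the coefficients change along the orbit and \<open>D\<close> does not.\<close>

definition conjugate_pair :: "int \<Rightarrow> real \<Rightarrow> real \<Rightarrow> bool" where
  "conjugate_pair D x y \<longleftrightarrow>
     (\<exists>a b c :: int. a \<noteq> 0 \<and> x + y = - of_int b / of_int a \<and> x * y = of_int c / of_int a \<and>
        b\<^sup>2 - 4 * a * c = D)"

lemma conjugate_pair_irrational: "conjugate_pair D x y \<Longrightarrow> x \<notin> \<rat> \<Longrightarrow> y \<notin> \<rat>"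
proof
  assume "conjugate_pair D x y" and x: "x \<notin> \<rat>" and "y \<in> \<rat>"
  then obtain a b :: int where "x + y = - of_int b / of_int a" by (auto simp: conjugate_pair_def)
  then have "x = - of_int b / of_int a - y" by simp
  also have "\<dots> \<in> \<rat>" using \<open>y \<in> \<rat>\<close> by simp
  finally show False using x by simp
qed

text \<open>Substituting \<open>X = 1/(Z + n)\<close> and clearing denominators gives
  \<open>c Z^2 + (b + 2 c n) Z + (a + b n + c n^2)\<close>, which has the same discriminant.\<close>

lemma conjugate_pair_step:
  assumes "conjugate_pair D x y" "x \<noteq> 0" "y \<noteq> 0"
  shows "conjugate_pair D (1/x - of_int n) (1/y - of_int n)"
proof -
  obtain a b c :: int where abc: "a \<noteq> 0" "x + y = - of_int b / of_int a" "x * y = of_int c / of_int a"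
    "b\<^sup>2 - 4 * a * c = D"
    using assms(1) by (auto simp: conjugate_pair_def)
  have c: "c \<noteq> 0" using abc(3) assms by auto
  have "1/x + 1/y = (x + y) / (x * y)" using assms by (simp add: field_simps)
  also have "\<dots> = - of_int b / of_int c" unfolding abc(2,3) using abc(1) by simp
  finally have s: "1/x + 1/y = - of_int b / of_int c" .
  have "1/x * (1/y) = 1 / (x * y)" by simp
  also have "\<dots> = of_int a / of_int c" unfolding abc(3) by simp
  finally have p: "1/x * (1/y) = of_int a / of_int c" .
  have "(1/x - of_int n) + (1/y - of_int n) = (1/x + 1/y) - 2 * of_int n" by simp
  also have "\<dots> = - of_int (b + 2 * c * n) / of_int c" unfolding s using c by (simp add: field_simps)
  finally have s': "(1/x - of_int n) + (1/y - of_int n) = - of_int (b + 2 * c * n) / of_int c" .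
  have "(1/x - of_int n) * (1/y - of_int n) = 1/x * (1/y) - of_int n * (1/x + 1/y) + of_int n * of_int n"
    by (simp add: algebra_simps)
  also have "\<dots> = of_int (a + b * n + c * n * n) / of_int c" unfolding s p using c by (simp add: field_simps)
  finally have p': "(1/x - of_int n) * (1/y - of_int n) = of_int (a + b * n + c * n * n) / of_int c" .
  have "(b + 2 * c * n)\<^sup>2 - 4 * c * (a + b * n + c * n * n) = D"
    using abc(4) by (simp add: power2_eq_square algebra_simps)
  with s' p' c show ?thesis unfolding conjugate_pair_def by blast
qed

lemma quadratic_irrational_conjugate:
  assumes "quadratic_irrational x"
  obtains D y where "conjugate_pair D x y" "x \<noteq> y"
proof -
  have irr: "x \<notin> \<rat>" using assms by (simp add: quadratic_irrational_def)
  obtain p q r :: rat where pqr: "(p, q, r) \<noteq> (0, 0, 0)"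
    "of_rat p * x\<^sup>2 + of_rat q * x + of_rat r = 0"
    using assms by (auto simp: quadratic_irrational_def)
  have "p \<noteq> 0"
  proof
    assume p: "p = 0"
    have "q \<noteq> 0" using pqr p by auto
    then have "x = - of_rat r / of_rat q" using pqr p by (simp add: field_simps)
    then show False using irr by simp
  qed
  obtain s t where u: "q / p = Fract s t" "t > 0" by (metis Rat_cases)
  obtain s' t' where v: "r / p = Fract s' t'" "t' > 0" by (metis Rat_cases)
  define y where "y = - of_rat (q / p) - x"
  have "x * y = of_rat (r / p)"
  proof -
    have "x * y = - (of_rat p * x\<^sup>2 + of_rat q * x + of_rat r) / of_rat p + of_rat (r / p)"
      using \<open>p \<noteq> 0\<close> by (simp add: y_def of_rat_divide power2_eq_square field_simps)
    then show ?thesis using pqr by simp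
  qed
  then have prod: "x * y = of_int s' / of_int t'" by (simp add: v Fract_of_int_quotient of_rat_divide)
  have sum: "x + y = - of_int s / of_int t" by (simp add: y_def u Fract_of_int_quotient of_rat_divide)
  \<comment> \<open>The monic polynomial with coefficients \<open>s/t\<close> and
    \<open>s'/t'\<close> is multiplied by \<open>t * t'\<close>.\<close>
  have "conjugate_pair ((s * t')\<^sup>2 - 4 * (t * t') * (s' * t)) x y"
    unfolding conjugate_pair_def
  proof (intro exI conjI)
    show "x + y = - of_int (s * t') / of_int (t * t')" using sum v(2) by simp
    show "x * y = of_int (s' * t) / of_int (t * t')" using prod u(2) by simp
  qed (use u v in auto)
  moreover have "x \<noteq> y"
  proof
    assume "x = y"
    then have "x = - of_rat (q / p) / 2" unfolding y_def by simp
    then show False using irr by simp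
  qed
  ultimately show ?thesis by (rule that)
qed

text \<open>If \<open>x > 0 > y\<close> then \<open>a c < 0\<close>, so \<open>D = b\<^sup>2 + 4 \<bar>a c\<bar>\<close> bounds all the coefficients.\<close>
lemma finite_conjugate_pairs_opposite_sign:
  "finite {x. 0 < x \<and> (\<exists>y<0. conjugate_pair D x y)}"
proof -
  let ?I = "{- \<bar>D\<bar>..\<bar>D\<bar>}"
  \<comment> \<open>The quadratic formula, with \<open>s\<close> selecting the sign of the square
    root.\<close>
  let ?g = "\<lambda>(a, b, s). (- of_int b + of_int s * sqrt (of_int D)) / (2 * of_int a) :: real"
  have "{x. 0 < x \<and> (\<exists>y<0. conjugate_pair D x y)} \<subseteq> ?g ` (?I \<times> ?I \<times> {-1, 1})"
  proof
    fix x assume "x \<in> {x. 0 < x \<and> (\<exists>y<0. conjugate_pair D x y)}"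
    then obtain y where xy: "0 < x" "y < 0" "conjugate_pair D x y" by blast
    then obtain a b c :: int where abc: "a \<noteq> 0" "x + y = - of_int b / of_int a"
      "x * y = of_int c / of_int a" "b\<^sup>2 - 4 * a * c = D"
      by (auto simp: conjugate_pair_def)
    have "real_of_int c / of_int a < 0" using xy mult_pos_neg[of x y] abc(3) by simp
    then have "real_of_int (a * c) < 0"
      by (auto simp: divide_less_0_iff mult_less_0_iff)
    then have ac: "a * c < 0" by linarith
    then have "c \<noteq> 0" by auto
    have "1 \<le> \<bar>c\<bar>" using \<open>c \<noteq> 0\<close> by linarith
    then have "\<bar>a\<bar> \<le> \<bar>a * c\<bar>" using mult_left_mono[of 1 "\<bar>c\<bar>" "\<bar>a\<bar>"] by (simp add: abs_mult)
    moreover have "\<bar>b\<bar> \<le> b\<^sup>2"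
      using power2_abs[of b] mult_left_mono[of 1 "\<bar>b\<bar>" "\<bar>b\<bar>"]
      by (cases "b = 0") (auto simp: power2_eq_square)
    moreover have "0 \<le> b\<^sup>2" by simp
    ultimately have bounds: "a \<in> ?I" "b \<in> ?I" using abc(4) ac by auto
    have "of_int a * (x + y) = - of_int b" "of_int a * (x * y) = of_int c"
      using abc by auto
    then have "(2 * of_int a * x + of_int b)\<^sup>2 = (of_int b)\<^sup>2 - 4 * of_int a * (of_int c :: real)"
      by algebra
    also have "\<dots> = of_int D" using abc(4) by (metis of_int_diff of_int_mult of_int_numeral of_int_power)
    finally have sq: "(2 * of_int a * x + of_int b)\<^sup>2 = of_int D" .
    then have "\<bar>2 * of_int a * x + of_int b\<bar> = sqrt (of_int D)" by (metis real_sqrt_abs)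
    then obtain s :: int where "s \<in> {-1, 1}" "2 * of_int a * x + of_int b = of_int s * sqrt (of_int D)"
      using that[of 1] that[of "- 1"] by (cases "0 \<le> 2 * of_int a * x + of_int b") auto
    then have "x = ?g (a, b, s)" using abc(1) by (simp add: field_simps)
    then show "x \<in> ?g ` (?I \<times> ?I \<times> {-1, 1})" using bounds \<open>s \<in> {-1, 1}\<close> by blast
  qed
  then show ?thesis by (rule finite_subset) auto
qed

text \<open>Lagrange's theorem.  While the conjugate stays positive it has the same partial quotients as
  the iterate, so the distance of the two doubles at least every other step; once it is negative it
  remains so.\<close>
lemma finite_gauss_orbit:
  assumes "quadratic_irrational x" "x \<in> {0<..<1}"
  shows "finite (range (\<lambda>i. (gauss_map ^^ i) x))"
proof -
  obtain D y where y: "conjugate_pair D x y" "x \<noteq> y"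
    using quadratic_irrational_conjugate[OF assms(1)] .
  define X where "X i = (gauss_map ^^ i) x" for i
  \<comment> \<open>The conjugate is moved by the partial quotients of \<open>X\<close>, not by its
    own, so that each pair remains conjugate.\<close>
  define Y where "Y = rec_nat y (\<lambda>i z. 1/z - of_int \<lfloor>1 / X i\<rfloor>)"
  have X0: "X 0 = x" and Y0: "Y 0 = y" by (simp_all add: X_def Y_def)
  have X_Suc: "X (Suc i) = 1 / X i - of_int \<lfloor>1 / X i\<rfloor>" for i
    by (simp add: X_def gauss_map_def frac_def)
  have Y_Suc: "Y (Suc i) = 1 / Y i - of_int \<lfloor>1 / X i\<rfloor>" for i
    by (simp add: Y_def)
  have X: "X i \<notin> \<rat> \<and> X i \<in> {0<..<1}" for i
  proof (induction i)
    case 0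
    then show ?case using assms by (simp add: X0 quadratic_irrational_def)
  next
    case (Suc i)
    then show ?case using gauss_map_irrational gauss_map_unit by (simp add: X_def)
  qed
  then have X_pos: "0 < X i" "X i < 1" for i by auto
  have floor_X: "1 \<le> \<lfloor>1 / X i\<rfloor>" for i using X_pos[of i] by (simp add: le_floor_iff)
  have pair: "conjugate_pair D (X i) (Y i) \<and> Y i \<noteq> 0" for i
  proof (induction i)
    case 0
    have "y \<notin> \<rat>" using conjugate_pair_irrational[OF y(1)] X[of 0] X0 by simp
    then show ?case using y by (auto simp: X0 Y0)
  next
    case (Suc i)
    have "X i \<noteq> 0" using X_pos[of i] by simp
    then have p: "conjugate_pair D (X (Suc i)) (Y (Suc i))"
      unfolding X_Suc Y_Suc using Suc by (intro conjugate_pair_step) auto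
    then have "Y (Suc i) \<notin> \<rat>" using conjugate_pair_irrational X by blast
    then show ?case using p by auto
  qed
  have "\<exists>i. Y i < 0"
  proof (rule ccontr)
    assume "\<not> (\<exists>i. Y i < 0)"
    then have Y_pos: "0 < Y i" for i using pair[of i] by (meson linorder_neqE_linordered_idom)
    have Y_lt: "Y i < 1" for i
    proof -
      have "1 < 1 / Y i" using Y_Suc[of i] Y_pos[of "Suc i"] floor_X[of i] by linarith
      then show ?thesis using Y_pos[of i] by simp
    qed
    \<comment> \<open>The product equals \<open>1 - u * k\<close>, hence is at most
      \<open>1 - u\<close>; it is also at most \<open>u\<close>, and one of these is at most
      \<open>1/2\<close>.\<close>
    have half: "u * (1/u - of_int k) \<le> 1/2" if "0 < u" "u < 1" "1 \<le> k" "1/u - of_int k < 1"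
      for u :: real and k :: int
    proof -
      have "u * (1/u - of_int k) \<le> u" using mult_left_mono[of "1/u - of_int k" 1 u] that by simp
      moreover have "u * (1/u - of_int k) = 1 - u * of_int k" using that by (simp add: field_simps)
      moreover have "u \<le> u * of_int k" using that mult_left_mono[of 1 "of_int k" u] by simp
      ultimately show ?thesis by linarith
    qed
    define d where "d i = \<bar>X i - Y i\<bar>" for i
    have d_Suc: "d i = d (Suc i) * (X i * Y i)" for i
    proof -
      have "X (Suc i) - Y (Suc i) = (Y i - X i) / (X i * Y i)"
        using X_pos[of i] Y_pos[of i] by (simp add: X_Suc Y_Suc field_simps)
      then show ?thesis using X_pos[of i] Y_pos[of i] by (simp add: d_def abs_mult)
    qed
    have d_double: "2 * d i \<le> d (Suc (Suc i))" for i
    proof -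
      have "X i * X (Suc i) \<le> 1/2"
        using half[of "X i" "\<lfloor>1 / X i\<rfloor>"] X_pos[of i] X_pos[of "Suc i"] floor_X by (simp add: X_Suc)
      moreover have "Y i * Y (Suc i) \<le> 1"
        using Y_pos[of i] Y_pos[of "Suc i"] Y_lt by (intro mult_le_one) (auto simp: less_imp_le)
      ultimately have "(X i * X (Suc i)) * (Y i * Y (Suc i)) \<le> 1/2 * 1"
        using X_pos Y_pos by (intro mult_mono) (auto simp: less_imp_le)
      then have "d (Suc (Suc i)) * ((X i * X (Suc i)) * (Y i * Y (Suc i))) \<le> d (Suc (Suc i)) * (1/2)"
        by (intro mult_left_mono) (auto simp: d_def)
      then show ?thesis using d_Suc[of i] d_Suc[of "Suc i"] by (simp add: mult_ac)
    qed
    have "2 ^ j * d 0 \<le> d (2 * j)" for j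
    proof (induction j)
      case (Suc j)
      then show ?case using d_double[of "2 * j"] by simp
    qed simp
    \<comment> \<open>Two points of the unit interval are at distance at most \<open>1\<close>,
      which contradicts the unbounded doubling.\<close>
    moreover have "d i \<le> 1" for i using X_pos[of i] Y_pos[of i] Y_lt[of i] by (simp add: d_def abs_le_iff)
    ultimately have bound: "2 ^ j * d 0 \<le> 1" for j by (meson order_trans)
    have "0 < d 0" using y(2) by (simp add: d_def X0 Y0)
    moreover obtain j where "1 / d 0 < 2 ^ j" using real_arch_pow[of 2 "1 / d 0"] by auto
    ultimately show False using bound[of j] by (simp add: field_simps)
  qed
  then obtain m where m: "Y m < 0" by blast
  have neg: "Y i < 0" if "m \<le> i" for i
    using that
  proof (induction i rule: nat_induct_at_least)
    case (Suc i)
    have "1 / Y i < 0" using Suc by simp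
    then show ?case using floor_X[of i] unfolding Y_Suc by linarith
  qed (rule m)
  \<comment> \<open>From \<open>m\<close> on, the iterates are positive with negative conjugates of
    the fixed discriminant \<open>D\<close>; only the first \<open>m\<close> iterates
    remain.\<close>
  have "range X \<subseteq> X ` {..<m} \<union> {x. 0 < x \<and> (\<exists>y<0. conjugate_pair D x y)}"
  proof
    fix z assume "z \<in> range X"
    then obtain i where i: "z = X i" by blast
    show "z \<in> X ` {..<m} \<union> {x. 0 < x \<and> (\<exists>y<0. conjugate_pair D x y)}"
      using i neg[of i] pair[of i] X_pos[of i] by (cases "i < m") auto
  qed
  then have "finite (range X)"
    by (rule finite_subset) (simp add: finite_conjugate_pairs_opposite_sign)
  then show ?thesis by (simp add: X_def[abs_def])
qed

section \<open>Rational projection and conclusion\<close>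

text \<open>Over the rationals \<open>{1}\<close> is linearly independent in the reals, so the
  assignment of \<open>1\<close> to \<open>1\<close> extends to a linear map.\<close>

lemma rat_linear_projection_exists:
  obtains \<phi> :: "real \<Rightarrow> rat" where "\<And>x y. \<phi> (x + y) = \<phi> x + \<phi> y"
    "\<And>q x. \<phi> (of_rat q * x) = q * \<phi> x" "\<And>q. \<phi> (of_rat q) = q"
proof -
  interpret vector_space_pair "\<lambda>q x. of_rat q * x :: real" "(*) :: rat \<Rightarrow> rat \<Rightarrow> rat"
    by unfold_locales (simp_all add: algebra_simps of_rat_add of_rat_mult)
  have "vs1.independent {1}" by (simp add: vs1.dependent_single)
  then obtain \<phi> :: "real \<Rightarrow> rat"
    where lin: "Vector_Spaces.linear (\<lambda>q x. of_rat q * x) (*) \<phi>" and one: "\<phi> 1 = 1"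
    using linear_independent_extend[of "{1}" "\<lambda>_. 1"] by blast
  interpret Vector_Spaces.linear "\<lambda>q x. of_rat q * x :: real" "(*) :: rat \<Rightarrow> rat \<Rightarrow> rat" \<phi> by (rule lin)
  show ?thesis
  proof
    show "\<phi> (of_rat q) = q" for q using scale[of q 1] one by simp
  qed (simp_all add: add scale)
qed

theorem mainTheorem15:
  fixes x :: real
  assumes "x \<in> {0..1}" and "quadratic_irrational x"
  shows "interrobang x \<in> \<rat>"
proof -
  have irr: "x \<notin> \<rat>" using assms(2) by (simp add: quadratic_irrational_def)
  then have "x \<noteq> 0" "x \<noteq> 1" by auto
  then have x: "x \<in> {0<..<1}" using assms(1) by auto
  define S where "S = range (\<lambda>i. (gauss_map ^^ i) x)"
  have "finite S" unfolding S_def by (rule finite_gauss_orbit[OF assms(2) x])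
  have S_closed: "gauss_map z \<in> S" if z: "z \<in> S" for z
  proof -
    obtain i where "z = (gauss_map ^^ i) x" using z unfolding S_def by blast
    then have "gauss_map z = (gauss_map ^^ Suc i) x" by simp
    then show ?thesis unfolding S_def by blast
  qed
  have "(gauss_map ^^ 0) x \<in> S" unfolding S_def by blast
  then have "x \<in> S" by simp
  have "(gauss_map ^^ i) x \<notin> \<rat> \<and> (gauss_map ^^ i) x \<in> {0<..<1}" for i
    by (induction i) (use irr x gauss_map_irrational gauss_map_unit in auto)
  then have S_irr: "z \<notin> \<rat>" "0 < z" "z < 1" if "z \<in> S" for z using that by (auto simp: S_def)
  obtain \<phi> :: "real \<Rightarrow> rat" where \<phi>: "\<And>x y. \<phi> (x + y) = \<phi> x + \<phi> y"
    "\<And>q x. \<phi> (of_rat q * x) = q * \<phi> x" "\<And>q. \<phi> (of_rat q) = q"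
    using rat_linear_projection_exists by metis
  \<comment> \<open>The defect \<open>h\<close> vanishes exactly where the value is
    rational.\<close>
  define h where "h z = interrobang z - of_rat (\<phi> (interrobang z))" for z
  obtain z where z: "z \<in> S" "\<And>w. w \<in> S \<Longrightarrow> \<bar>h w\<bar> \<le> \<bar>h z\<bar>"
  proof -
    have "Max ((\<lambda>w. \<bar>h w\<bar>) ` S) \<in> (\<lambda>w. \<bar>h w\<bar>) ` S"
      using \<open>finite S\<close> \<open>x \<in> S\<close> by (intro Max_in) auto
    then obtain z where "z \<in> S" "\<bar>h z\<bar> = Max ((\<lambda>w. \<bar>h w\<bar>) ` S)" by auto
    then show ?thesis using that[of z] \<open>finite S\<close> by simp
  qed
  let ?z1 = "gauss_map z" and ?z2 = "gauss_map (gauss_map z)"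
  obtain a b c :: rat where abc: "\<bar>a\<bar> + \<bar>b\<bar> \<le> 13/16"
    "interrobang z = of_rat c + of_rat a * interrobang ?z1 + of_rat b * interrobang ?z2"
    using interrobang_eqs_gauss_recursion[OF interrobang_eqs_interrobang S_irr(2,3,1)] z(1) by blast
  have "\<phi> (interrobang z) = c + a * \<phi> (interrobang ?z1) + b * \<phi> (interrobang ?z2)"
    unfolding abc(2) by (simp add: \<phi>)
  \<comment> \<open>The inhomogeneous term \<open>c\<close> cancels because \<open>\<phi>\<close>
    fixes rationals; what remains is the homogeneous recursion.\<close>
  then have "h z = of_rat a * h ?z1 + of_rat b * h ?z2"
    unfolding h_def abc(2) by (simp add: of_rat_add of_rat_mult algebra_simps)
  then have "\<bar>h z\<bar> \<le> \<bar>of_rat a\<bar> * \<bar>h ?z1\<bar> + \<bar>of_rat b\<bar> * \<bar>h ?z2\<bar>"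
    by (metis abs_mult abs_triangle_ineq)
  also have "\<dots> \<le> \<bar>of_rat a\<bar> * \<bar>h z\<bar> + \<bar>of_rat b\<bar> * \<bar>h z\<bar>"
    using z S_closed by (intro add_mono mult_left_mono) auto
  also have "\<dots> = of_rat (\<bar>a\<bar> + \<bar>b\<bar>) * \<bar>h z\<bar>"
    by (simp add: of_rat_add algebra_simps)
  also have "\<dots> \<le> of_rat (13/16) * \<bar>h z\<bar>"
    using abc(1) by (intro mult_right_mono) (simp_all only: of_rat_less_eq abs_ge_zero)
  finally have "\<bar>h z\<bar> \<le> 13/16 * \<bar>h z\<bar>" by (simp add: of_rat_divide)
  then have "\<bar>h x\<bar> \<le> 0" using z(2)[OF \<open>x \<in> S\<close>] by argo
  then have "interrobang x = of_rat (\<phi> (interrobang x))" by (simp add: h_def)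
  then show ?thesis by (metis Rats_of_rat)
qed

end
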